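(* For every $n\in\mathbb{N}$, $\theta_n(B_n)\le\sqrt{n+1}$, and the equality $\theta_n(B_n)=\sqrt{n+1}$ is possible only if $n=m^2-1$ for some integer $m\ge2$.
   Context: $B_n=\{x\in\mathbb{R}^n:\|x\|\le1\}$ is the Euclidean unit ball. $C(B_n)$ is the space of continuous functions $f:B_n\to\mathbb{R}$ with norm $\|f\|_{C(B_n)}=\max_{x\in B_n}|f(x)|$. $\Pi_1(\mathbb{R}^n)$ is the set of real polynomials in $n$ variables of degree at most $1$. For a nondegenerate $n$-dimensional simplex $S$ with vertices $x^{(1)},\dots,x^{(n+1)}\in B_n$, the interpolation projector $P:C(B_n)\to\Pi_1(\mathbb{R}^n)$ corresponding to $S$ is determined by $Pf(x^{(j)})=f(x^{(j)})$ for $1\le j\le n+1$. $\|P\|_{B_n}$ is the norm of $P$ as an operator from $C(B_n)$ to $C(B_n)$ (with $Pf$ restricted to $B_n$). $\theta_n(B_n)$ is the minimal value of $\|P\|_{B_n}$ over all interpolation projectors $P$ corresponding to nondegenerate simplices with vertices in $B_n$. *)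

theory Defs
  imports "HOL-Analysis.Analysis"
begin

text \<open>
  The space \<open>\<real>\<^sup>n\<close> is \<open>real ^ 'n\<close> with \<open>n = CARD('n)\<close>, and \<open>B\<^sub>n\<close> is \<open>cball 0 1\<close>.
  A function on \<open>B\<^sub>n\<close> is represented by any function on \<open>real ^ 'n\<close>: everything below
  depends only on its values on \<open>B\<^sub>n\<close>.
\<close>

definition C_ball :: "(real ^ 'n \<Rightarrow> real) set" where
  "C_ball = {f. continuous_on (cball 0 1) f}"

definition C_norm :: "(real ^ 'n \<Rightarrow> real) \<Rightarrow> real" where
  "C_norm f = (SUP x\<in>cball 0 1. \<bar>f x\<bar>)"

definition Pi1 :: "(real ^ 'n \<Rightarrow> real) set" where
  "Pi1 = {p. \<exists>c a. p = (\<lambda>x. c + (\<Sum>i\<in>UNIV. a i * x $ i))}"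

definition vertices :: "(real ^ 'n) set \<Rightarrow> (real ^ 'n) set" where
  "vertices S = {v. v extreme_point_of S}"

text \<open>The library predicate \<^const>\<open>simplex\<close> requires affinely independent vertices, so
  \<open>int CARD('n) simplex S\<close> says that \<open>S\<close> is a nondegenerate \<open>n\<close>-dimensional simplex.\<close>

definition simplices_in_ball :: "(real ^ 'n) set set" where
  "simplices_in_ball = {S. int CARD('n) simplex S \<and> vertices S \<subseteq> cball 0 1}"

definition interp_projector ::
    "(real ^ 'n) set \<Rightarrow> (real ^ 'n \<Rightarrow> real) \<Rightarrow> (real ^ 'n \<Rightarrow> real)" where
  "interp_projector S f = (THE p. p \<in> Pi1 \<and> (\<forall>v\<in>vertices S. p v = f v))"

definition operator_norm ::
    "((real ^ 'n \<Rightarrow> real) \<Rightarrow> (real ^ 'n \<Rightarrow> real)) \<Rightarrow> real" where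
  "operator_norm P = (SUP f\<in>{f \<in> C_ball. C_norm f \<le> 1}. C_norm (P f))"

text \<open>The infimum is attained, by compactness of \<open>B\<^sub>n\<close>, hence is the minimal projector norm.\<close>

definition theta_ball :: "'n::finite itself \<Rightarrow> real" where
  "theta_ball _ = (INF S\<in>(simplices_in_ball :: (real ^ 'n) set set).
     operator_norm (interp_projector S))"

end

theory Submission
  imports Defs
begin

text \<open>
  The bound comes from one simplex, the regular one inscribed in the ball. If \<open>V\<close> is its set of
  \<open>n + 1\<close> vertices, then \<open>v \<bullet> w = - 1 / n\<close> for distinct vertices, so its barycentric coordinates
  (the Lagrange basis of the interpolation) are \<open>l v x = (1 + n (v \<bullet> x)) / (n + 1)\<close>.
  Interpolation reproduces the affine functions \<open>1\<close> and \<open>y \<mapsto> y \<bullet> x\<close>; evaluated at \<open>x\<close>, this says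
  \<open>(\<Sum>v\<in>V. l v x) = 1\<close> and \<open>(\<Sum>v\<in>V. (v \<bullet> x) * l v x) = x \<bullet> x\<close>, and together they give
  \<open>(\<Sum>v\<in>V. (l v x)\<^sup>2) = (1 + n (x \<bullet> x)) / (n + 1) \<le> 1\<close> on the ball. As the projector norm is at most the
  maximum over the ball of \<open>\<Sum>v\<in>V. \<bar>l v x\<bar>\<close> (lemma \<open>operator_norm_lagrange\<close>), the Cauchy-Schwarz
  inequality bounds it by \<open>sqrt (n + 1)\<close>.

  If the minimal norm equals \<open>sqrt (n + 1)\<close>, then that maximum does too, and by compactness it is
  attained at some \<open>x\<close>. Equality in Cauchy-Schwarz forces \<open>\<bar>l v x\<bar> = 1 / sqrt (n + 1)\<close> for every \<open>v\<close>,
  and since the \<open>l v x\<close> add up to \<open>1\<close>, the number \<open>sqrt (n + 1)\<close> is a sum of signs, hence an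
  integer (lemma \<open>sum_abs_eq_sqrt_card\<close>).
\<close>

section \<open>Interpolation by affine functions\<close>

lemma Pi1_iff_inner:
  fixes p :: "real ^ 'n::finite \<Rightarrow> real"
  shows "p \<in> Pi1 \<longleftrightarrow> (\<exists>c a. p = (\<lambda>x. c + a \<bullet> x))"
proof
  assume "p \<in> Pi1"
  then obtain c a where "p = (\<lambda>x. c + (\<Sum>i\<in>UNIV. a i * x $ i))"
    unfolding Pi1_def by blast
  then have "p = (\<lambda>x. c + (\<chi> i. a i) \<bullet> x)"
    by (simp add: inner_vec_def)
  then show "\<exists>c a. p = (\<lambda>x. c + a \<bullet> x)" by blast
next
  assume "\<exists>c a. p = (\<lambda>x. c + a \<bullet> x)"
  then obtain c a where "p = (\<lambda>x. c + a \<bullet> x)" by blast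
  then have "p = (\<lambda>x. c + (\<Sum>i\<in>UNIV. (a $ i) * x $ i))"
    by (simp add: inner_vec_def)
  then show "p \<in> Pi1"
    unfolding Pi1_def by blast
qed

lemma Pi1_continuous_on:
  fixes p :: "real ^ 'n::finite \<Rightarrow> real"
  assumes "p \<in> Pi1"
  shows "continuous_on A p"
proof -
  obtain c a where "p = (\<lambda>x. c + a \<bullet> x)"
    using assms by (auto simp: Pi1_iff_inner)
  then show ?thesis by (auto intro!: continuous_intros)
qed

lemma Pi1_sum:
  fixes l :: "'b \<Rightarrow> real ^ 'n::finite \<Rightarrow> real"
  assumes "\<And>v. v \<in> V \<Longrightarrow> l v \<in> Pi1"
  shows "(\<lambda>x. \<Sum>v\<in>V. u v * l v x) \<in> Pi1"
proof -
  have "\<forall>v\<in>V. \<exists>c a. l v = (\<lambda>x. c + a \<bullet> x)"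
    using assms by (auto simp: Pi1_iff_inner)
  then obtain c a where "\<forall>v\<in>V. l v = (\<lambda>x. c v + a v \<bullet> x)" by metis
  then have "(\<lambda>x. \<Sum>v\<in>V. u v * l v x)
      = (\<lambda>x. (\<Sum>v\<in>V. u v * c v) + (\<Sum>v\<in>V. u v *\<^sub>R a v) \<bullet> x)"
    by (simp add: fun_eq_iff inner_sum_left algebra_simps sum.distrib)
  then show ?thesis unfolding Pi1_iff_inner by blast
qed

lemma Pi1_eqI:
  fixes p q :: "real ^ 'n::finite \<Rightarrow> real"
  assumes "p \<in> Pi1" "q \<in> Pi1" "\<And>v. v \<in> V \<Longrightarrow> p v = q v" "affine hull V = UNIV"
  shows "p = q"
proof -
  obtain c a where p: "p = (\<lambda>x. c + a \<bullet> x)"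
    using assms(1) by (auto simp: Pi1_iff_inner)
  obtain d b where q: "q = (\<lambda>x. d + b \<bullet> x)"
    using assms(2) by (auto simp: Pi1_iff_inner)
  have eq: "{x. p x = q x} = {x. (a - b) \<bullet> x = d - c}"
    by (auto simp: p q algebra_simps)
  have "affine {x. p x = q x}"
    unfolding eq by (rule affine_hyperplane)
  then have "affine hull V \<subseteq> {x. p x = q x}"
    using assms(3) by (intro hull_minimal) auto
  then show ?thesis
    using assms(4) by auto
qed

definition lagrange_basis ::
    "(real ^ 'n) set \<Rightarrow> (real ^ 'n \<Rightarrow> real ^ 'n \<Rightarrow> real) \<Rightarrow> bool" where
  "lagrange_basis V l \<longleftrightarrow>
    (\<forall>v\<in>V. l v \<in> Pi1 \<and> (\<forall>w\<in>V. l v w = (if v = w then 1 else 0)))"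

text \<open>Choosing one of the points as origin turns the remaining ones into a linearly independent
  family, on which a linear functional may take arbitrary values.\<close>

lemma lagrange_basis_exists:
  fixes V :: "(real ^ 'n::finite) set"
  assumes "\<not> affine_dependent V"
  shows "\<exists>l. lagrange_basis V l"
proof -
  have interpolant: "\<exists>p\<in>Pi1. \<forall>w\<in>V. p w = f w" for f :: "real ^ 'n \<Rightarrow> real"
  proof (cases "V = {}")
    case True
    have "(\<lambda>x. 0 + (0 :: real ^ 'n) \<bullet> x) \<in> Pi1"
      unfolding Pi1_iff_inner by blast
    then show ?thesis using True by blast
  next
    case False
    then obtain a where a: "a \<in> V" by blast
    let ?D = "(\<lambda>x. - a + x) ` (V - {a})"
    have "independent ?D"
      using assms affine_dependent_iff_dependent2[OF a] by blast
    from linear_independent_extend[OF this, of "\<lambda>y. f (a + y) - f a"]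
    obtain g where g: "linear g" "\<forall>y\<in>?D. g y = f (a + y) - f a" by blast
    obtain b where b: "g = (\<lambda>x. b \<bullet> x)"
    proof
      show "g = (\<lambda>x. adjoint g 1 \<bullet> x)"
        using adjoint_works[OF g(1)] by (simp add: fun_eq_iff inner_commute)
    qed
    have "(\<lambda>x. (f a - b \<bullet> a) + b \<bullet> x) \<in> Pi1"
      unfolding Pi1_iff_inner by blast
    moreover have "(f a - b \<bullet> a) + b \<bullet> w = f w" if "w \<in> V" for w
    proof (cases "w = a")
      case False
      then have "g (- a + w) = f w - f a"
        using g(2) that by auto
      then have "b \<bullet> w - b \<bullet> a = f w - f a"
        by (simp add: b inner_diff_right)
      then show ?thesis by linarith
    qed simp
    ultimately show ?thesis
      by (intro bexI[of _ "\<lambda>x. (f a - b \<bullet> a) + b \<bullet> x"]) auto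
  qed
  have "\<forall>v. \<exists>p. p \<in> Pi1 \<and> (\<forall>w\<in>V. p w = (if v = w then 1 else 0))"
    using interpolant[of "\<lambda>w. if v = w then 1 else 0" for v] by (simp add: Bex_def)
  then obtain l where "\<forall>v. l v \<in> Pi1 \<and> (\<forall>w\<in>V. l v w = (if v = w then 1 else 0))" by metis
  then show ?thesis unfolding lagrange_basis_def by blast
qed

text \<open>Conversely, \<open>l v\<close> vanishes on the affine hull of the other points but not at \<open>v\<close>.\<close>

lemma lagrange_basis_independent:
  fixes V :: "(real ^ 'n::finite) set"
  assumes "lagrange_basis V l"
  shows "\<not> affine_dependent V"
proof
  assume "affine_dependent V"
  then obtain v where v: "v \<in> V" "v \<in> affine hull (V - {v})"
    unfolding affine_dependent_def by blast
  obtain c a where l: "l v = (\<lambda>x. c + a \<bullet> x)"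
    using assms v(1) by (auto simp: lagrange_basis_def Pi1_iff_inner)
  have eq: "{x. l v x = 0} = {x. a \<bullet> x = - c}"
    by (auto simp: l)
  have "affine {x. l v x = 0}"
    unfolding eq by (rule affine_hyperplane)
  then have "affine hull (V - {v}) \<subseteq> {x. l v x = 0}"
    using assms v(1) by (intro hull_minimal) (auto simp: lagrange_basis_def)
  then show False
    using v assms by (auto simp: lagrange_basis_def)
qed

lemma lagrange_basis_interpolates:
  assumes "lagrange_basis V l" "finite V" "w \<in> V"
  shows "(\<Sum>v\<in>V. f v * l v w) = f w"
proof -
  have "(\<Sum>v\<in>V. f v * l v w) = (\<Sum>v\<in>V. if v = w then f v else 0)"
    using assms by (intro sum.cong) (auto simp: lagrange_basis_def)
  then show ?thesis
    using assms by simp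
qed

lemma Pi1_reproduction:
  fixes V :: "(real ^ 'n::finite) set"
  assumes "lagrange_basis V l" "finite V" "affine hull V = UNIV" "p \<in> Pi1"
  shows "(\<Sum>v\<in>V. p v * l v x) = p x"
proof -
  have "(\<lambda>x. \<Sum>v\<in>V. p v * l v x) = p"
  proof (rule Pi1_eqI)
    show "(\<lambda>x. \<Sum>v\<in>V. p v * l v x) \<in> Pi1"
      using assms(1) by (intro Pi1_sum) (auto simp: lagrange_basis_def)
  qed (use assms lagrange_basis_interpolates in auto)
  then show ?thesis by (rule fun_cong)
qed

lemma independent_affine_hull_UNIV:
  fixes V :: "(real ^ 'n::finite) set"
  assumes "\<not> affine_dependent V" "card V = CARD('n) + 1"
  shows "affine hull V = UNIV"
proof -
  have "aff_dim V = int DIM(real ^ 'n)"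
    using aff_dim_affine_independent[OF assms(1)] assms(2) by simp
  then show ?thesis
    by (rule iffD1[OF aff_dim_eq_full])
qed

section \<open>The norm of the projector\<close>

lemma C_norm_ge:
  fixes f :: "real ^ 'n::finite \<Rightarrow> real"
  assumes "f \<in> C_ball" "x \<in> cball 0 1"
  shows "\<bar>f x\<bar> \<le> C_norm f"
proof -
  have "continuous_on (cball 0 1) (\<lambda>x. \<bar>f x\<bar>)"
    using assms(1) by (auto simp: C_ball_def intro!: continuous_intros)
  then have "bdd_above ((\<lambda>x. \<bar>f x\<bar>) ` cball 0 1)"
    by (intro bounded_imp_bdd_above compact_imp_bounded compact_continuous_image) auto
  then show ?thesis
    unfolding C_norm_def using assms(2) by (intro cSUP_upper)
qed

lemma interp_projector_convex_hull:
  fixes V :: "(real ^ 'n::finite) set"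
  assumes "lagrange_basis V l" "card V = CARD('n) + 1"
  shows "interp_projector (convex hull V) f = (\<lambda>x. \<Sum>v\<in>V. f v * l v x)"
proof -
  have indep: "\<not> affine_dependent V"
    using assms(1) by (rule lagrange_basis_independent)
  have fin: "finite V"
    using assms(2) by (intro card_ge_0_finite) simp
  have verts: "vertices (convex hull V) = V"
    using extreme_point_of_convex_hull_affine_independent[OF indep] by (auto simp: vertices_def)
  have Pi1: "(\<lambda>x. \<Sum>v\<in>V. f v * l v x) \<in> Pi1"
    using assms(1) by (intro Pi1_sum) (auto simp: lagrange_basis_def)
  show ?thesis
    unfolding interp_projector_def verts
  proof (rule the_equality)
    show "(\<lambda>x. \<Sum>v\<in>V. f v * l v x) \<in> Pi1 \<and> (\<forall>w\<in>V. (\<Sum>v\<in>V. f v * l v w) = f w)"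
      using Pi1 lagrange_basis_interpolates[OF assms(1) fin] by blast
  next
    fix p assume p: "p \<in> Pi1 \<and> (\<forall>v\<in>V. p v = f v)"
    show "p = (\<lambda>x. \<Sum>v\<in>V. f v * l v x)"
      using p Pi1 lagrange_basis_interpolates[OF assms(1) fin, of _ f]
        independent_affine_hull_UNIV[OF indep assms(2)]
      by (intro Pi1_eqI[where V = V]) auto
  qed
qed

text \<open>The point \<open>x\<close> is a maximum of the Lebesgue function \<open>\<lambda>x. \<Sum>v\<in>V. \<bar>l v x\<bar>\<close> on the ball. The lower
  bound also needs an upper one, since the supremum of an unbounded set of reals is a default value.\<close>

lemma operator_norm_lagrange:
  fixes V :: "(real ^ 'n::finite) set"
  assumes "lagrange_basis V l" "card V = CARD('n) + 1" "V \<subseteq> cball 0 1"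
  obtains x where "x \<in> cball 0 1"
    "0 \<le> operator_norm (interp_projector (convex hull V))"
    "operator_norm (interp_projector (convex hull V)) \<le> (\<Sum>v\<in>V. \<bar>l v x\<bar>)"
proof -
  let ?P = "interp_projector (convex hull V)"
  let ?F = "{f :: real ^ 'n \<Rightarrow> real. f \<in> C_ball \<and> C_norm f \<le> 1}"
  note P = interp_projector_convex_hull[OF assms(1,2)]
  have l: "l v \<in> Pi1" if "v \<in> V" for v
    using assms(1) that by (auto simp: lagrange_basis_def)
  have "\<exists>x\<in>cball 0 1. \<forall>y\<in>cball 0 1. (\<Sum>v\<in>V. \<bar>l v y\<bar>) \<le> (\<Sum>v\<in>V. \<bar>l v x\<bar>)"
  proof (rule continuous_attains_sup)
    show "continuous_on (cball 0 1) (\<lambda>y. \<Sum>v\<in>V. \<bar>l v y\<bar>)"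
      by (rule continuous_on_sum, rule continuous_on_rabs, rule Pi1_continuous_on, rule l)
  qed simp_all
  then obtain x where x: "x \<in> cball 0 1"
    and max: "\<And>y. y \<in> cball 0 1 \<Longrightarrow> (\<Sum>v\<in>V. \<bar>l v y\<bar>) \<le> (\<Sum>v\<in>V. \<bar>l v x\<bar>)" by blast
  have upper: "C_norm (?P f) \<le> (\<Sum>v\<in>V. \<bar>l v x\<bar>)" if f: "f \<in> ?F" for f
    unfolding C_norm_def
  proof (rule cSUP_least)
    fix y :: "real ^ 'n" assume y: "y \<in> cball 0 1"
    have fv: "\<bar>f v\<bar> \<le> 1" if "v \<in> V" for v
      using C_norm_ge[of f v] f that assms(3) by fastforce
    have "\<bar>?P f y\<bar> \<le> (\<Sum>v\<in>V. \<bar>f v * l v y\<bar>)"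
      unfolding P by (rule sum_abs)
    also have "\<dots> \<le> (\<Sum>v\<in>V. \<bar>l v y\<bar>)"
      using fv by (intro sum_mono) (simp add: abs_mult mult_left_le_one_le)
    also have "\<dots> \<le> (\<Sum>v\<in>V. \<bar>l v x\<bar>)"
      using y by (rule max)
    finally show "\<bar>?P f y\<bar> \<le> (\<Sum>v\<in>V. \<bar>l v x\<bar>)" .
  qed simp
  have zero: "(\<lambda>_. 0) \<in> ?F"
    by (auto simp: C_ball_def C_norm_def)
  have "operator_norm ?P \<le> (\<Sum>v\<in>V. \<bar>l v x\<bar>)"
    unfolding operator_norm_def using zero by (intro cSUP_least upper) auto
  moreover have "0 \<le> operator_norm ?P"
  proof -
    have "bdd_above ((\<lambda>f. C_norm (?P f)) ` ?F)"
      using upper by (intro bdd_aboveI2)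
    then have "C_norm (?P (\<lambda>_. 0)) \<le> operator_norm ?P"
      unfolding operator_norm_def using zero by (intro cSUP_upper)
    then show ?thesis by (simp add: P C_norm_def)
  qed
  ultimately show thesis using x that by blast
qed

lemma convex_hull_in_simplices:
  fixes V :: "(real ^ 'n::finite) set"
  assumes "\<not> affine_dependent V" "card V = CARD('n) + 1" "V \<subseteq> cball 0 1"
  shows "convex hull V \<in> simplices_in_ball"
proof -
  have "vertices (convex hull V) = V"
    using extreme_point_of_convex_hull_affine_independent[OF assms(1)] by (auto simp: vertices_def)
  moreover have "int CARD('n) simplex (convex hull V)"
    unfolding simplex_def using assms by (intro exI[of _ V]) auto
  ultimately show ?thesis
    using assms(3) by (auto simp: simplices_in_ball_def)
qed

lemma operator_norm_nonneg:
  fixes S :: "(real ^ 'n::finite) set"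
  assumes "S \<in> simplices_in_ball"
  shows "0 \<le> operator_norm (interp_projector S)"
proof -
  obtain V where V: "\<not> affine_dependent V" "int (card V) = int CARD('n) + 1" "S = convex hull V"
    using assms by (auto simp: simplices_in_ball_def simplex_def)
  have "vertices S = V"
    using extreme_point_of_convex_hull_affine_independent[OF V(1)] V(3)
    by (auto simp: vertices_def)
  then have ball: "V \<subseteq> cball 0 1"
    using assms by (auto simp: simplices_in_ball_def)
  have card: "card V = CARD('n) + 1"
    using V(2) by linarith
  obtain l where "lagrange_basis V l"
    using lagrange_basis_exists[OF V(1)] by blast
  from operator_norm_lagrange[OF this card ball] show ?thesis
    using V(3) by metis
qed

section \<open>The regular simplex\<close>

text \<open>One vertex lies on the diagonal; the others are a common multiple of the unit vectors shifted
  along the diagonal. The coefficient \<open>a\<close> of the unit vectors satisfies \<open>a\<^sup>2 = 1 + 1 / n\<close>, the value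
  of \<open>v \<bullet> v - v \<bullet> w\<close>; the shift is then fixed by the product with the first vertex.\<close>

lemma regular_simplex_exists:
  obtains V :: "(real ^ 'n::finite) set"
  where "card V = CARD('n) + 1"
    "\<And>v w. v \<in> V \<Longrightarrow> w \<in> V \<Longrightarrow> v \<bullet> w = (if v = w then 1 else - 1 / real CARD('n))"
proof -
  define n where "n = real CARD('n)"
  define r where "r = 1 / sqrt n"
  define a where "a = sqrt (1 + 1 / n)"
  define b where "b = (r - a) / n"
  define D :: "real ^ 'n" where "D = (\<chi> i. 1)"
  define X where "X k = (case k of None \<Rightarrow> - r *\<^sub>R D | Some i \<Rightarrow> a *\<^sub>R axis i 1 + b *\<^sub>R D)"
    for k :: "'n option"
  have n: "n > 0"
    by (simp add: n_def)
  have rr: "r * r = 1 / n" and aa: "a * a = 1 + 1 / n"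
    using n by (auto simp: r_def a_def)
  have nb: "n * b = r - a"
    using n by (simp add: b_def)
  have DD: "D \<bullet> D = n"
    by (simp add: D_def inner_vec_def n_def)
  have AD: "axis i 1 \<bullet> D = 1" "D \<bullet> axis i 1 = 1" for i
    by (auto simp: D_def inner_axis inner_axis')
  have AA: "axis i 1 \<bullet> (axis j 1 :: real ^ 'n) = (if i = j then 1 else 0)" for i j
    by (simp add: inner_axis_axis)
  have none: "r * (r * n) = 1"
    using n by (simp add: mult.assoc[symmetric] rr)
  have mixed: "r * a + r * (b * n) = 1 / n"
  proof -
    have "r * a + r * (b * n) = r * a + r * (n * b)" by (simp add: mult.commute)
    also have "\<dots> = r * r" unfolding nb by (simp add: algebra_simps)
    finally show ?thesis by (simp add: rr)
  qed
  have some: "2 * (a * b) + b * (b * n) = - 1 / n"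
  proof -
    have "n * (2 * (a * b) + b * (b * n)) = (n * b) * (2 * a + n * b)"
      by (simp add: algebra_simps)
    also have "\<dots> = r * r - a * a"
      unfolding nb by (simp add: algebra_simps)
    also have "\<dots> = - 1"
      by (simp add: rr aa)
    finally show ?thesis
      using n nonzero_eq_divide_eq[of n "2 * (a * b) + b * (b * n)" "- 1"]
      by (metis less_irrefl mult.commute)
  qed
  have gram_None: "X None \<bullet> X None = 1"
    by (simp add: X_def DD none)
  have gram_mixed: "X None \<bullet> X (Some i) = - 1 / n" for i
  proof -
    have "X None \<bullet> X (Some i) = - (r * a + r * (b * n))"
      by (simp add: X_def inner_add_right AD DD ring_distribs)
    then show ?thesis unfolding mixed by simp
  qed
  have gram_Some: "X (Some i) \<bullet> X (Some j) = (if i = j then 1 else - 1 / n)" for i j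
  proof -
    have "X (Some i) \<bullet> X (Some j)
        = a * a * (if i = j then 1 else 0) + (2 * (a * b) + b * (b * n))"
      by (simp add: X_def inner_add_left inner_add_right AD AA DD ring_distribs)
    then show ?thesis unfolding some aa by simp
  qed
  have gram: "X k \<bullet> X m = (if k = m then 1 else - 1 / n)" for k m
    using gram_None gram_mixed gram_Some by (cases k; cases m) (auto simp: inner_commute)
  have "inj X"
  proof
    fix k m assume "X k = X m"
    then have "X k \<bullet> X m = 1" using gram[of m m] by simp
    then show "k = m"
      using gram[of k m] n by (cases "k = m") (auto simp: field_simps)
  qed
  show thesis
  proof
    show "card (range X) = CARD('n) + 1"
      using \<open>inj X\<close> by (simp add: card_image)
  next
    fix v w assume "v \<in> range X" "w \<in> range X"
    then show "v \<bullet> w = (if v = w then 1 else - 1 / real CARD('n))"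
      using gram \<open>inj X\<close> by (auto simp: n_def inj_eq)
  qed
qed

text \<open>The two sums are the reproduction of the affine functions \<open>1\<close> and \<open>y \<mapsto> x \<bullet> y\<close> at the point \<open>x\<close>;
  the second one gives the sum of squares because \<open>l v x\<close> is itself affine in \<open>v \<bullet> x\<close>.\<close>

lemma regular_simplex_coordinates:
  fixes V :: "(real ^ 'n::finite) set" and x :: "real ^ 'n"
  assumes l_eq: "\<And>v y. l v y = (1 + real CARD('n) * (v \<bullet> y)) / (real CARD('n) + 1)"
    and card: "card V = CARD('n) + 1"
    and gram: "\<And>v w. v \<in> V \<Longrightarrow> w \<in> V \<Longrightarrow> v \<bullet> w = (if v = w then 1 else - 1 / real CARD('n))"
  shows "lagrange_basis V l"
    and "(\<Sum>v\<in>V. l v x) = 1"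
    and "(\<Sum>v\<in>V. (l v x)\<^sup>2) = (1 + real CARD('n) * (x \<bullet> x)) / (real CARD('n) + 1)"
proof -
  define n where "n = real CARD('n)"
  have n: "n > 0"
    by (simp add: n_def)
  have l: "l v y = (1 + n * (v \<bullet> y)) / (n + 1)" for v y
    by (simp add: l_eq n_def)
  have "l v = (\<lambda>y. 1 / (n + 1) + ((n / (n + 1)) *\<^sub>R v) \<bullet> y)" for v
    by (simp add: fun_eq_iff l add_divide_distrib)
  then have "l v \<in> Pi1" for v
    unfolding Pi1_iff_inner by blast
  moreover have "l v w = (if v = w then 1 else 0)" if "v \<in> V" "w \<in> V" for v w
    using gram[OF that] n by (auto simp: l n_def[symmetric])
  ultimately show basis: "lagrange_basis V l"
    by (simp add: lagrange_basis_def)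
  have fin: "finite V"
    using card by (intro card_ge_0_finite) simp
  note reproduction = Pi1_reproduction[OF basis fin
      independent_affine_hull_UNIV[OF lagrange_basis_independent[OF basis] card]]
  have "(\<lambda>y. 1 + (0 :: real ^ 'n) \<bullet> y) \<in> Pi1"
    unfolding Pi1_iff_inner by blast
  from reproduction[OF this] show one: "(\<Sum>v\<in>V. l v x) = 1"
    by simp
  have "(\<lambda>y. 0 + x \<bullet> y) \<in> Pi1"
    unfolding Pi1_iff_inner by blast
  from reproduction[OF this] have inner: "(\<Sum>v\<in>V. (v \<bullet> x) * l v x) = x \<bullet> x"
    by (simp add: inner_commute)
  have square: "(l v x)\<^sup>2 = (l v x + n * ((v \<bullet> x) * l v x)) / (n + 1)" for v
  proof -
    have "(l v x)\<^sup>2 = l v x * ((1 + n * (v \<bullet> x)) / (n + 1))"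
      unfolding power2_eq_square by (subst (2) l) (rule refl)
    then show ?thesis by (simp add: algebra_simps)
  qed
  have "(\<Sum>v\<in>V. (l v x)\<^sup>2) = (\<Sum>v\<in>V. (l v x + n * ((v \<bullet> x) * l v x)) / (n + 1))"
    by (simp only: square)
  also have "\<dots> = (1 + n * (x \<bullet> x)) / (n + 1)"
    by (simp add: sum_divide_distrib[symmetric] sum.distrib sum_distrib_left[symmetric] one inner)
  finally show "(\<Sum>v\<in>V. (l v x)\<^sup>2) = (1 + real CARD('n) * (x \<bullet> x)) / (real CARD('n) + 1)"
    by (simp add: n_def)
qed

section \<open>The extremal case of the Cauchy-Schwarz inequality\<close>

text \<open>Expanding the squares on the left gives
  \<open>s\<^sup>2 * (\<Sum>v\<in>V. (u v)\<^sup>2) - 2 * s * (\<Sum>v\<in>V. \<bar>u v\<bar>) + s\<^sup>2\<close>. This is the Cauchy-Schwarz inequality with its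
  defect: the left side is nonnegative, and it vanishes only if all \<open>\<bar>u v\<bar>\<close> equal \<open>1 / s\<close>.\<close>

lemma sum_square_deviation_le:
  fixes u :: "'b \<Rightarrow> real"
  assumes "(\<Sum>v\<in>V. (u v)\<^sup>2) \<le> 1"
  defines "s \<equiv> sqrt (real (card V))"
  shows "(\<Sum>v\<in>V. (s * \<bar>u v\<bar> - 1)\<^sup>2) \<le> 2 * s * (s - (\<Sum>v\<in>V. \<bar>u v\<bar>))"
proof -
  have ss: "s * s = real (card V)"
    by (simp add: s_def)
  have "(\<Sum>v\<in>V. (s * \<bar>u v\<bar> - 1)\<^sup>2) = (\<Sum>v\<in>V. (s * s) * (u v)\<^sup>2 - 2 * s * \<bar>u v\<bar> + 1)"
    by (intro sum.cong refl) (simp add: power2_diff power_mult_distrib power2_eq_square[of s])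
  also have "\<dots> = (s * s) * (\<Sum>v\<in>V. (u v)\<^sup>2) - 2 * s * (\<Sum>v\<in>V. \<bar>u v\<bar>) + s * s"
    by (simp add: sum.distrib sum_subtractf sum_distrib_left ss)
  also have "\<dots> \<le> s * s - 2 * s * (\<Sum>v\<in>V. \<bar>u v\<bar>) + s * s"
    using assms(1) by (simp add: mult_left_le)
  finally show ?thesis by (simp add: algebra_simps)
qed

lemma sum_abs_le_sqrt_card:
  fixes u :: "'b \<Rightarrow> real"
  assumes "(\<Sum>v\<in>V. (u v)\<^sup>2) \<le> 1" "card V > 0"
  shows "(\<Sum>v\<in>V. \<bar>u v\<bar>) \<le> sqrt (real (card V))"
proof -
  let ?s = "sqrt (real (card V))"
  have "0 \<le> (\<Sum>v\<in>V. (?s * \<bar>u v\<bar> - 1)\<^sup>2)"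
    by (intro sum_nonneg) simp
  then have "0 \<le> 2 * ?s * (?s - (\<Sum>v\<in>V. \<bar>u v\<bar>))"
    using sum_square_deviation_le[OF assms(1)] by linarith
  then show ?thesis
    using assms(2) by (simp add: zero_le_mult_iff)
qed

text \<open>With \<open>s = sqrt (card V)\<close>, every \<open>s * u v\<close> is a sign, and these signs add up to \<open>s\<close>.\<close>

lemma sum_abs_eq_sqrt_card:
  fixes u :: "'b \<Rightarrow> real"
  assumes "(\<Sum>v\<in>V. (u v)\<^sup>2) \<le> 1" "card V > 0" "(\<Sum>v\<in>V. u v) = 1"
    and "sqrt (real (card V)) \<le> (\<Sum>v\<in>V. \<bar>u v\<bar>)"
  shows "sqrt (real (card V)) \<in> \<int>"
proof -
  define s where "s = sqrt (real (card V))"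
  have fin: "finite V"
    using assms(2) by (rule card_ge_0_finite)
  have s: "s > 0"
    using assms(2) by (simp add: s_def)
  have "2 * s * (s - (\<Sum>v\<in>V. \<bar>u v\<bar>)) \<le> 0"
    using s assms(4) by (simp add: s_def mult_le_0_iff)
  then have "(\<Sum>v\<in>V. (s * \<bar>u v\<bar> - 1)\<^sup>2) \<le> 0"
    using sum_square_deviation_le[OF assms(1)] by (simp add: s_def)
  then have "(\<Sum>v\<in>V. (s * \<bar>u v\<bar> - 1)\<^sup>2) = 0"
    by (intro antisym sum_nonneg) simp_all
  then have "\<forall>v\<in>V. (s * \<bar>u v\<bar> - 1)\<^sup>2 = 0"
    using fin by (subst (asm) sum_nonneg_eq_0_iff) auto
  then have sign: "s * \<bar>u v\<bar> = 1" if "v \<in> V" for v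
    using that by simp
  have "s * u v \<in> \<int>" if "v \<in> V" for v
  proof (cases "u v \<ge> 0")
    case True
    then show ?thesis using sign[OF that] by simp
  next
    case False
    then have "s * u v = - 1" using sign[OF that] by simp
    then show ?thesis by simp
  qed
  then have "(\<Sum>v\<in>V. s * u v) \<in> \<int>"
    by (intro Ints_sum)
  then show ?thesis
    by (simp add: sum_distrib_left[symmetric] assms(3) s_def)
qed

section \<open>The minimal norm\<close>

theorem mainTheorem4:
  shows "theta_ball TYPE('n::finite) \<le> sqrt (real CARD('n) + 1) \<and>
    (theta_ball TYPE('n) = sqrt (real CARD('n) + 1) \<longrightarrow>
      (\<exists>m::int. m \<ge> 2 \<and> int CARD('n) = m\<^sup>2 - 1))"
proof -
  obtain V :: "(real ^ 'n) set" where card: "card V = CARD('n) + 1"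
    and gram: "\<And>v w. v \<in> V \<Longrightarrow> w \<in> V \<Longrightarrow> v \<bullet> w = (if v = w then 1 else - 1 / real CARD('n))"
    using regular_simplex_exists by metis
  define l where "l v x = (1 + real CARD('n) * (v \<bullet> x)) / (real CARD('n) + 1)"
    for v x :: "real ^ 'n"
  have basis: "lagrange_basis V l"
    using l_def card gram by (rule regular_simplex_coordinates(1))
  have ball: "V \<subseteq> cball 0 1"
    using gram by (auto simp: norm_eq_sqrt_inner)
  obtain x where x: "x \<in> cball 0 1"
    and norm_le: "operator_norm (interp_projector (convex hull V)) \<le> (\<Sum>v\<in>V. \<bar>l v x\<bar>)"
    using operator_norm_lagrange[OF basis card ball] by metis
  have "bdd_below ((\<lambda>S. operator_norm (interp_projector S)) `
      (simplices_in_ball :: (real ^ 'n) set set))"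
    by (intro bdd_belowI2[where m = 0] operator_norm_nonneg)
  then have "theta_ball TYPE('n) \<le> operator_norm (interp_projector (convex hull V))"
    unfolding theta_ball_def
    by (intro cINF_lower convex_hull_in_simplices lagrange_basis_independent[OF basis] card ball)
  with norm_le have theta: "theta_ball TYPE('n) \<le> (\<Sum>v\<in>V. \<bar>l v x\<bar>)" by linarith
  have "x \<bullet> x \<le> 1"
    using x power_le_one[of "norm x" 2] by (simp add: power2_norm_eq_inner)
  then have "(1 + real CARD('n) * (x \<bullet> x)) / (real CARD('n) + 1) \<le> 1"
    by (simp add: mult_left_le divide_le_eq)
  moreover have "(\<Sum>v\<in>V. (l v x)\<^sup>2) = (1 + real CARD('n) * (x \<bullet> x)) / (real CARD('n) + 1)"
    using l_def card gram by (rule regular_simplex_coordinates(3))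
  ultimately have squares: "(\<Sum>v\<in>V. (l v x)\<^sup>2) \<le> 1" by linarith
  have one: "(\<Sum>v\<in>V. l v x) = 1"
    using l_def card gram by (rule regular_simplex_coordinates(2))
  have pos: "card V > 0" and sqrt: "sqrt (real (card V)) = sqrt (real CARD('n) + 1)"
    using card by simp_all
  have "theta_ball TYPE('n) \<le> sqrt (real CARD('n) + 1)"
    using theta sum_abs_le_sqrt_card[OF squares pos] unfolding sqrt by linarith
  moreover have "\<exists>m::int. m \<ge> 2 \<and> int CARD('n) = m\<^sup>2 - 1"
    if "theta_ball TYPE('n) = sqrt (real CARD('n) + 1)"
  proof -
    have "sqrt (real (card V)) \<in> \<int>"
      using theta that by (intro sum_abs_eq_sqrt_card[OF squares pos one]) (simp add: sqrt)
    then obtain m :: int where m: "sqrt (real CARD('n) + 1) = of_int m"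
      unfolding sqrt by (auto elim: Ints_cases)
    have "real_of_int (m\<^sup>2) = real CARD('n) + 1"
      using m[symmetric] by simp
    then have "real_of_int (m\<^sup>2) = real_of_int (int CARD('n) + 1)"
      by simp
    then have "m\<^sup>2 = int CARD('n) + 1"
      by (simp only: of_int_eq_iff)
    moreover have "m \<ge> 2"
    proof -
      have "sqrt (real CARD('n) + 1) > 1" by simp
      then show ?thesis unfolding m by simp
    qed
    ultimately show ?thesis by (intro exI[of _ m]) simp
  qed
  ultimately show ?thesis by blast
qed

end
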